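(* Let $1<p_1\le p_2\le p_3\le\cdots$ be a Beurling generalized prime number system (an unbounded non-decreasing sequence of reals with $p_1>1$), let $1=n_0<n_1\le n_2\le\cdots$ be the associated generalized integers, and let $N(x)=\sum_{n_k\le x}1$ and $\psi(x)=\sum_{n_k\le x}\Lambda(n_k)$. Suppose that the prime number theorem $\psi(x)\sim x$ holds and that, for some $a>0$, $$N(x)=ax+o\left(\frac{x}{\log x}\right),\quad x\to\infty,\qquad\text{and}\qquad \int_1^\infty\left|\frac{N(x)-ax}{x^2}\right|\,\mathrm{d}x<\infty.$$ Then the limit $\lim_{x\to\infty}\left(\sum_{n_k\le x}\frac{1}{n_k}-a\log x\right)$ exists and $$\psi_1(x):=\sum_{n_k\le x}\frac{\Lambda(n_k)}{n_k}=\log x+c+o(1),\quad x\to\infty,$$ with $$c=-1-\frac{1}{a}\int_1^\infty\frac{N(x)-ax}{x^2}\,\mathrm{d}x=-\frac{1}{a}\lim_{x\to\infty}\left(\sum_{n_k\le x}\frac{1}{n_k}-a\log x\right).$$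
   Context: The generalized integers are the elements of the multiplicative semigroup generated by the generalized primes and $1$, listed in non-decreasing order with multiplicities. With $\pi(x)=\#\{k:p_k\le x\}$ and $\Pi(x)=\sum_{j\ge1}\frac1j\pi(x^{1/j})$, the Chebyshev function is $\psi(x)=\int_1^x\log t\,\mathrm{d}\Pi(t)=\sum_{n_k\le x}\Lambda(n_k)$ (this defines the generalized von Mangoldt function $\Lambda$: $\Lambda(n_k)=\log p_j$ if $n_k$ is a power $p_j^m$ of a single generalized prime, and $0$ otherwise), and $\psi_1(x)=\int_1^x t^{-1}\mathrm{d}\psi(t)$. The relation $\psi(x)\sim x$ is called the PNT. *)

theory Defs
  imports "HOL-Analysis.Analysis" "HOL-Library.Landau_Symbols" "HOL-Library.Multiset"
begin

text \<open>
  The sequence \<open>p\<close> is indexed from 0, so \<open>p 0\<close> is the first generalized prime.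
\<close>

definition beurling_primes :: "(nat \<Rightarrow> real) \<Rightarrow> bool" where
  "beurling_primes p \<longleftrightarrow> 1 < p 0 \<and> mono p \<and> \<not> bdd_above (range p)"

text \<open>
  Generalized integers are counted with multiplicity: distinct formal products of primes are
  distinct even if they have the same real value. A formal product is a multiset of indices of
  generalized primes, the empty multiset standing for the generalized integer 1.
\<close>

definition formal_value :: "(nat \<Rightarrow> real) \<Rightarrow> nat multiset \<Rightarrow> real" where
  "formal_value p M = (\<Prod>j\<in>#M. p j)"

text \<open>
  The map \<open>e\<close> lists every formal product exactly once, in non-decreasing order of
  real values. Only the order among products of equal value is not determined by \<open>p\<close>.
\<close>

definition gint_listing :: "(nat \<Rightarrow> real) \<Rightarrow> (nat \<Rightarrow> nat multiset) \<Rightarrow> bool" where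
  "gint_listing p e \<longleftrightarrow> bij e \<and> mono (\<lambda>k. formal_value p (e k))"

definition gint :: "(nat \<Rightarrow> real) \<Rightarrow> (nat \<Rightarrow> nat multiset) \<Rightarrow> nat \<Rightarrow> real" where
  "gint p e k = formal_value p (e k)"

text \<open>
  The von Mangoldt function depends on the formal product and not just on its real value: a
  product of two different generalized primes (possibly equal as reals) gets the value 0 even
  if its real value happens to be a prime power. This is what makes
  \<open>\<psi>(x) = \<integral>\<^sub>1\<^sup>x log t d\<Pi>(t)\<close> hold, as each power \<open>p\<^sub>j\<^sup>m\<close> contributes
  \<open>log p\<^sub>j\<close> once.
\<close>

definition formal_mangoldt :: "(nat \<Rightarrow> real) \<Rightarrow> nat multiset \<Rightarrow> real" where
  "formal_mangoldt p M =
     (if \<exists>j m. 0 < m \<and> M = replicate_mset m j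
      then ln (p (THE j. \<exists>m>0. M = replicate_mset m j)) else 0)"

definition gmangoldt :: "(nat \<Rightarrow> real) \<Rightarrow> (nat \<Rightarrow> nat multiset) \<Rightarrow> nat \<Rightarrow> real" where
  "gmangoldt p e k = formal_mangoldt p (e k)"

definition gN :: "(nat \<Rightarrow> real) \<Rightarrow> (nat \<Rightarrow> nat multiset) \<Rightarrow> real \<Rightarrow> real" where
  "gN p e x = (\<Sum>k | gint p e k \<le> x. 1)"

definition gpsi :: "(nat \<Rightarrow> real) \<Rightarrow> (nat \<Rightarrow> nat multiset) \<Rightarrow> real \<Rightarrow> real" where
  "gpsi p e x = (\<Sum>k | gint p e k \<le> x. gmangoldt p e k)"

definition gpsi1 :: "(nat \<Rightarrow> real) \<Rightarrow> (nat \<Rightarrow> nat multiset) \<Rightarrow> real \<Rightarrow> real" where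
  "gpsi1 p e x = (\<Sum>k | gint p e k \<le> x. gmangoldt p e k / gint p e k)"

lemma formal_mangoldt_prime_power:
  assumes "0 < m"
  shows "formal_mangoldt p (replicate_mset m j) = ln (p j)"
proof -
  have "(THE j'. \<exists>m'>0. replicate_mset m j = replicate_mset m' j') = j"
  proof (rule the_equality)
    fix j' assume "\<exists>m'>0. replicate_mset m j = replicate_mset m' j'"
    then obtain m' where m': "m' > 0" and eq: "replicate_mset m j = replicate_mset m' j'"
      by blast
    from eq have "set_mset (replicate_mset m j) = set_mset (replicate_mset m' j')" by (rule arg_cong)
    then show "j' = j" using assms m' by simp
  qed (use assms in auto)
  moreover have "\<exists>j' m'. 0 < m' \<and> replicate_mset m j = replicate_mset m' j'"
    using assms by blast
  ultimately show ?thesis unfolding formal_mangoldt_def by (simp only: if_True)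
qed

lemma beurling_primes_gt_1:
  assumes "beurling_primes p" shows "1 < p j" "p 0 \<le> p j"
proof -
  have *: "1 < p 0" "p 0 \<le> p j"
    using assms unfolding beurling_primes_def by (auto dest: monoD)
  show "p 0 \<le> p j" by (fact *)
  show "1 < p j" using * by linarith
qed

lemma power_size_le_formal_value:
  assumes "beurling_primes p"
  shows "p 0 ^ size M \<le> formal_value p M"
proof (induction M)
  case (add j M)
  have "p 0 * p 0 ^ size M \<le> p j * formal_value p M"
    using add beurling_primes_gt_1[OF assms, of j] beurling_primes_gt_1(1)[OF assms, of 0]
    by (intro mult_mono) auto
  then show ?case by (simp add: formal_value_def)
qed (simp add: formal_value_def)

lemma formal_value_ge_1:
  assumes "beurling_primes p" shows "1 \<le> formal_value p M"
  using power_size_le_formal_value[OF assms, of M] beurling_primes_gt_1(1)[OF assms, of 0]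
    one_le_power[of "p 0" "size M"] by linarith

lemma prime_le_formal_value:
  assumes "beurling_primes p" "j \<in># M" shows "p j \<le> formal_value p M"
proof -
  obtain M' where M: "M = add_mset j M'" using assms(2) by (metis insert_DiffM)
  have "p j * 1 \<le> p j * formal_value p M'"
    using formal_value_ge_1[OF assms(1)] beurling_primes_gt_1(1)[OF assms(1), of j]
    by (intro mult_left_mono) auto
  then show ?thesis by (simp add: M formal_value_def)
qed

lemma finite_formal_value_le:
  assumes "beurling_primes p" shows "finite {M. formal_value p M \<le> x}"
proof -
  obtain K where K: "x < p K"
    using assms unfolding beurling_primes_def bdd_above_def by (auto simp: not_le)
  obtain m where m: "x < p 0 ^ m"
    using real_arch_pow[OF beurling_primes_gt_1(1)[OF assms]] by blast
  have "{M. formal_value p M \<le> x} \<subseteq> mset ` {xs. set xs \<subseteq> {..<K} \<and> length xs \<le> m}"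
  proof
    fix M assume "M \<in> {M. formal_value p M \<le> x}"
    then have M: "formal_value p M \<le> x" by simp
    obtain xs where xs: "mset xs = M" using ex_mset by blast
    have "set xs \<subseteq> {..<K}"
    proof
      fix j assume "j \<in> set xs"
      then have "j \<in># M" using xs by auto
      then have "p j < p K" using prime_le_formal_value[OF assms] M K by fastforce
      then show "j \<in> {..<K}"
        using assms monoD[of p K j] unfolding beurling_primes_def by (cases "K \<le> j") auto
    qed
    moreover have "p 0 ^ size M < p 0 ^ m"
      using power_size_le_formal_value[OF assms, of M] M m by linarith
    then have "size M < m"
      using beurling_primes_gt_1(1)[OF assms, of 0] by simp
    ultimately show "M \<in> mset ` {xs. set xs \<subseteq> {..<K} \<and> length xs \<le> m}"
      using xs by (intro image_eqI[of _ _ xs]) auto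
  qed
  then show ?thesis by (rule finite_subset) (intro finite_imageI finite_lists_length_le finite_lessThan)
qed

lemma gint_listing_exists:
  assumes "beurling_primes p" shows "\<exists>e. gint_listing p e"
proof -
  define v where "v = formal_value p"
  define c :: "nat multiset \<Rightarrow> nat" where "c M = to_nat (SOME xs. mset xs = M)" for M
  have "mset (SOME xs. mset xs = M) = M" for M :: "nat multiset"
    using ex_mset by (rule someI_ex)
  then have c: "M = M'" if "c M = c M'" for M M'
    using that unfolding c_def by (metis from_nat_to_nat)
  define lt where "lt M M' \<longleftrightarrow> v M < v M' \<or> (v M = v M' \<and> c M < c M')" for M M'
  have trans: "lt A C" if "lt A B" "lt B C" for A B C using that unfolding lt_def by auto
  have irrefl: "\<not> lt A A" for A unfolding lt_def by auto
  have total: "lt A B \<or> lt B A \<or> A = B" for A B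
    using c[of A B] unfolding lt_def by linarith
  define S where "S M = {M'. lt M' M}" for M
  define r where "r M = card (S M)" for M
  have finS: "finite (S M)" for M
    by (rule finite_subset[OF _ finite_formal_value_le[OF assms, of "v M"]])
      (auto simp: S_def lt_def v_def)
  have r_mono: "r A < r B" if "lt A B" for A B
    unfolding r_def
  proof (rule psubset_card_mono[OF finS])
    show "S A \<subset> S B" using that trans irrefl unfolding S_def by blast
  qed
  have inj: "inj r"
  proof (rule injI)
    fix A B assume "r A = r B"
    then show "A = B" using r_mono[of A B] r_mono[of B A] total[of A B] by auto
  qed
  have down: "r ` S M = {..<r M}" for M
  proof (rule card_subset_eq)
    show "r ` S M \<subseteq> {..<r M}" using r_mono by (auto simp: S_def)
    show "card (r ` S M) = card {..<r M}"
      using card_image[OF inj_on_subset[OF inj subset_UNIV], of "S M"] by (simp add: r_def)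
  qed simp
  have "inj (\<lambda>n::nat. {#n#})" by (rule injI) simp
  then have "infinite (range (\<lambda>n::nat. {#n#}))" by (simp add: finite_image_iff)
  then have "infinite (UNIV :: nat multiset set)" by (meson finite_subset subset_UNIV)
  then have inf: "infinite (range r)" using inj by (simp add: finite_image_iff)
  have "k \<in> range r" for k
  proof -
    obtain M where "k < r M" using inf unfolding infinite_nat_iff_unbounded by blast
    then have "k \<in> r ` S M" unfolding down by simp
    then show ?thesis by blast
  qed
  then have bij: "bij r" using inj unfolding bij_def by blast
  have "mono (\<lambda>k. v (inv r k))"
  proof (rule monoI, rule ccontr)
    fix k l :: nat assume kl: "k \<le> l" and "\<not> v (inv r k) \<le> v (inv r l)"
    then have "r (inv r l) < r (inv r k)" by (intro r_mono) (auto simp: lt_def)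
    then show False using kl bij by (simp add: bij_is_surj surj_f_inv_f)
  qed
  then show ?thesis
    using bij_imp_bij_inv[OF bij] unfolding gint_listing_def v_def by blast
qed

lemma finite_gint_le:
  assumes "beurling_primes p" "gint_listing p e"
  shows "finite {k. gint p e k \<le> x}"
proof -
  have "inj e" using assms(2) unfolding gint_listing_def bij_def by blast
  then show ?thesis
    using finite_vimageI[OF finite_formal_value_le[OF assms(1), of x], of e]
    by (simp add: gint_def vimage_def)
qed

lemma gint_0:
  assumes "beurling_primes p" "gint_listing p e"
  shows "gint p e 0 = 1"
proof -
  obtain k where "e k = {#}"
    using assms(2) unfolding gint_listing_def by (metis bij_pointE)
  moreover have "formal_value p (e 0) \<le> formal_value p (e k)"
    using assms(2) unfolding gint_listing_def mono_def by blast
  ultimately show ?thesis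
    using formal_value_ge_1[OF assms(1), of "e 0"] by (simp add: gint_def formal_value_def)
qed

end

theory Submission
  imports Defs
begin

text \<open>
  Write \<open>E(x) = N(x) - ax\<close>. Chebyshev's identity \<open>log * dN = dN * d\<psi>\<close> gives
  \<open>(1/x) \<Sum>\<^bsub>n \<le> x\<^esub> log n - a \<psi>\<^sub>1(x) = \<Sum>\<^bsub>n \<le> x\<^esub> (\<Lambda>(n)/n) E(x/n)/(x/n)\<close>, and
  \<open>E(x) = o(x / log x)\<close> turns the first term into \<open>a log x - a + o(1)\<close>. The right-hand side
  need not be pointwise tractable, since \<open>\<psi>\<close> may be badly distributed in short intervals.
  Averaging it over \<open>[X, eX]\<close> with respect to \<open>dx/x\<close>, however, turns it into
  \<open>\<integral>\<^sub>1\<^sup>\<infinity> (E(u)/u\<^sup>2) (\<psi>\<^sub>1(eX/u) - \<psi>\<^sub>1(X/u)) du\<close>. The PNT gives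
  \<open>\<psi>\<^sub>1(tx) - \<psi>\<^sub>1(x) \<rightarrow> log t\<close> for fixed \<open>t\<close>, so this integral tends to
  \<open>\<integral>\<^sub>1\<^sup>\<infinity> E(u)/u\<^sup>2 du\<close> by dominated convergence, and averaging changes
  \<open>\<psi>\<^sub>1(x) - log x\<close> only by \<open>o(1)\<close>.
\<close>

section \<open>Limits and substitutions for integrals on the real line\<close>

text \<open>Dominated convergence with majorant \<open>B * \<bar>k s\<bar>\<close>: wherever
  \<open>k s\<close> is nonzero, \<open>X * c s\<close> tends to infinity. It is applied with
  \<open>c s = s\<close> for means over windows proportional to \<open>X\<close>, and with
  \<open>c s = 1 / s\<close> for the multiplicative convolution.\<close>

lemma tendsto_integral_scaled:
  fixes g c k :: "real \<Rightarrow> real"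
  assumes [measurable]: "g \<in> borel_measurable borel" "c \<in> borel_measurable borel"
    and k: "integrable lborel k"
    and c: "\<And>s. k s \<noteq> 0 \<Longrightarrow> 0 < c s"
    and lim: "(g \<longlongrightarrow> l) at_top" and bound: "\<And>t. \<bar>g t\<bar> \<le> B"
  shows "((\<lambda>X. LINT s|lborel. g (X * c s) * k s) \<longlongrightarrow> l * (LINT s|lborel. k s)) at_top"
proof -
  have [measurable]: "k \<in> borel_measurable borel"
    using borel_measurable_integrable[OF k] by simp
  have "((\<lambda>X. LINT s|lborel. g (X * c s) * k s) \<longlongrightarrow> (LINT s|lborel. l * k s)) at_top"
  proof (rule integral_dominated_convergence_at_top[where w = "\<lambda>s. B * \<bar>k s\<bar>"])
    show "integrable lborel (\<lambda>s. B * \<bar>k s\<bar>)" using k by simp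
    have "((\<lambda>X. g (X * c s) * k s) \<longlongrightarrow> l * k s) at_top" for s
    proof (cases "k s = 0")
      case False
      have "filterlim (\<lambda>X. X * c s) at_top at_top"
        using filterlim_tendsto_pos_mult_at_top[OF tendsto_const c[OF False] filterlim_ident]
        by (simp add: mult.commute)
      then show ?thesis by (intro tendsto_intros filterlim_compose[OF lim])
    qed simp
    then show "AE s in lborel. ((\<lambda>X. g (X * c s) * k s) \<longlongrightarrow> l * k s) at_top" by simp
    show "\<forall>\<^sub>F X in at_top. AE s in lborel. norm (g (X * c s) * k s) \<le> B * \<bar>k s\<bar>"
      by (intro always_eventually allI AE_I2) (simp add: abs_mult mult_right_mono bound)
  qed measurable
  then show ?thesis by simp
qed

text \<open>Supplies the global bound \<open>B\<close> for \<open>tendsto_integral_scaled\<close>;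
  since that bound concerns all reals, the local hypothesis is about half-lines and not compact
  intervals.\<close>

lemma bounded_if_tendsto_at_top:
  fixes g :: "real \<Rightarrow> real"
  assumes lim: "(g \<longlongrightarrow> l) at_top" and loc: "\<And>X. \<exists>B. \<forall>t\<le>X. \<bar>g t\<bar> \<le> B"
  obtains B where "\<And>t. \<bar>g t\<bar> \<le> B"
proof -
  obtain X where X: "\<And>t. t \<ge> X \<Longrightarrow> \<bar>g t - l\<bar> < 1"
    using tendstoD[OF lim, of 1] unfolding eventually_at_top_linorder by (auto simp: dist_real_def)
  obtain B where B: "\<And>t. t \<le> X \<Longrightarrow> \<bar>g t\<bar> \<le> B" using loc by blast
  have "\<bar>g t\<bar> \<le> max B (\<bar>l\<bar> + 1)" for t
    using X[of t] B[of t] by linarith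
  then show ?thesis by (rule that)
qed

lemma has_bochner_integral_scale:
  fixes G :: "real \<Rightarrow> real"
  assumes "0 < c" "has_bochner_integral lborel G I"
  shows "has_bochner_integral lborel (\<lambda>t. c * G (c * t)) I"
proof -
  have "has_bochner_integral lborel (\<lambda>t. G (c * t)) (I / c)"
    using lborel_has_bochner_integral_real_affine_iff[of c G I 0] assms by (simp add: field_simps)
  from has_bochner_integral_mult_right[OF this, of c] show ?thesis using assms(1) by simp
qed

lemma has_bochner_integral_inverse_Icc:
  assumes "1 \<le> (b::real)"
  shows "has_bochner_integral lborel (\<lambda>t. 1 / t * indicator {1..b} t) (ln b)"
proof -
  have "has_bochner_integral lborel (\<lambda>t. 1 / t * indicator {1..b} t) (ln b - ln 1)"
    using assms
    by (intro has_bochner_integral_FTC_Icc_real)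
      (auto intro!: continuous_intros derivative_eq_intros simp: divide_simps)
  then show ?thesis by simp
qed

text \<open>The half-open window matches differences of summatory functions, which count the points
  in \<open>{x<..b * x}\<close>; the endpoint is a null set.\<close>

lemma has_bochner_integral_inverse_Ioc:
  assumes "1 \<le> (b::real)"
  shows "has_bochner_integral lborel (\<lambda>t. 1 / t * indicator {1<..b} t) (ln b)"
proof -
  note has_bochner_integral_inverse_Icc[OF assms]
  moreover have "AE t in lborel. 1 / t * indicator {1..b} t = 1 / t * indicator {1<..b} t"
    using AE_lborel_singleton[of "1::real"] by eventually_elim (auto simp: indicator_def)
  ultimately show ?thesis by (subst (asm) has_bochner_integral_cong_AE) auto
qed

section \<open>Summatory functions and partial summation\<close>

text \<open>The distribution function of the measure with mass \<open>w i\<close> at the point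
  \<open>v i\<close>. The weights 1, \<Lambda>, \<Lambda>/n, 1/n and log n give N, \<psi>,
  \<open>\<psi>\<^sub>1\<close>, the harmonic sum and the sum of logarithms.\<close>

definition csum :: "('i \<Rightarrow> real) \<Rightarrow> ('i \<Rightarrow> real) \<Rightarrow> real \<Rightarrow> real" where
  "csum v w x = (\<Sum>i | v i \<le> x. w i)"

text \<open>The index type is arbitrary, so that the analysis can later run over formal products
  themselves instead of positions in a listing.\<close>

locale counting =
  fixes v :: "'i \<Rightarrow> real"
  assumes ge_1: "1 \<le> v i" and fin: "finite {i. v i \<le> x}"
begin

lemma csum_eq_0: "x < 1 \<Longrightarrow> csum v w x = 0"
  using ge_1 by (auto simp: csum_def intro!: sum.neutral) (meson linorder_not_le order_trans)

lemma csum_mono: "(\<And>i. 0 \<le> w i) \<Longrightarrow> x \<le> y \<Longrightarrow> csum v w x \<le> csum v w y"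
  unfolding csum_def by (rule sum_mono2) (auto simp: fin)

lemma csum_nonneg: "(\<And>i. 0 \<le> w i) \<Longrightarrow> 0 \<le> csum v w x"
  unfolding csum_def by (simp add: sum_nonneg)

lemma csum_measurable: "(\<And>i. 0 \<le> w i) \<Longrightarrow> csum v w \<in> borel_measurable borel"
  by (intro borel_measurable_mono monoI csum_mono)

text \<open>Fixes one finite index set for all arguments up to \<open>y\<close>, so that finite sums
  and integrals over the argument can be interchanged.\<close>

lemma csum_extend:
  assumes "x \<le> y"
  shows "csum v w x = (\<Sum>i | v i \<le> y. if v i \<le> x then w i else 0)"
proof -
  have "{i. v i \<le> y} \<inter> {i. v i \<le> x} = {i. v i \<le> x}" using assms by auto
  then show ?thesis
    using sum.inter_restrict[OF fin[of y], of w "{i. v i \<le> x}"] by (simp add: csum_def)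
qed

text \<open>Abel summation: write \<open>G x - G (v i)\<close> as the integral of \<open>g\<close>
  over \<open>{v i..x}\<close>, multiply by \<open>w i\<close>, and sum under the integral sign; at
  each \<open>t\<close> in \<open>{1..x}\<close> the surviving weights are those with
  \<open>v i \<le> t\<close>.\<close>

lemma partial_summation:
  assumes deriv: "\<And>t. 1 \<le> t \<Longrightarrow> (G has_real_derivative g t) (at t)"
    and cont: "\<And>t. 1 \<le> t \<Longrightarrow> isCont g t"
  shows "has_bochner_integral lborel (\<lambda>t. csum v w t * g t * indicator {1..x} t)
           (csum v w x * G x - csum v (\<lambda>i. w i * G (v i)) x)"
proof -
  have "has_bochner_integral lborel (\<lambda>t. g t * indicator {v i..x} t) (G x - G (v i))"
    if "v i \<le> x" for i
    using that ge_1[of i] by (intro has_bochner_integral_FTC_Icc_real deriv cont) auto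
  then have "has_bochner_integral lborel
      (\<lambda>t. \<Sum>i | v i \<le> x. w i * (g t * indicator {v i..x} t)) (\<Sum>i | v i \<le> x. w i * (G x - G (v i)))"
    by (intro has_bochner_integral_sum has_bochner_integral_mult_right) auto
  also have "(\<lambda>t. \<Sum>i | v i \<le> x. w i * (g t * indicator {v i..x} t)) =
      (\<lambda>t. csum v w t * g t * indicator {1..x} t)"
  proof
    fix t
    show "(\<Sum>i | v i \<le> x. w i * (g t * indicator {v i..x} t)) =
      csum v w t * g t * indicator {1..x} t"
    proof (cases "t \<in> {1..x}")
      case True
      then show ?thesis
        by (auto simp: csum_extend[of t x] sum_distrib_right intro!: sum.cong)
    next
      case False
      then have "indicator {v i..x} t = (0::real)" for i
        using order_trans[OF ge_1[of i], of t] by (auto simp: indicator_def)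
      with False show ?thesis by simp
    qed
  qed
  also have "(\<Sum>i | v i \<le> x. w i * (G x - G (v i))) =
      csum v w x * G x - csum v (\<lambda>i. w i * G (v i)) x"
    by (simp add: csum_def sum_distrib_right sum_subtractf right_diff_distrib)
  finally show ?thesis .
qed

text \<open>Partial summation with \<open>G t = - 1 / t\<close>. It relates
  \<open>\<psi>\<^sub>1\<close> to \<psi>, and the harmonic sum to N.\<close>

lemma csum_div_parts:
  "has_bochner_integral lborel (\<lambda>t. csum v w t / t\<^sup>2 * indicator {1..x} t)
    (csum v (\<lambda>i. w i / v i) x - csum v w x / x)"
proof -
  have "has_bochner_integral lborel (\<lambda>t. csum v w t * (1 / t\<^sup>2) * indicator {1..x} t)
    (csum v w x * (- 1 / x) - csum v (\<lambda>i. w i * (- 1 / v i)) x)"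
    by (rule partial_summation)
      (auto intro!: derivative_eq_intros continuous_intros simp: power2_eq_square)
  moreover have "csum v (\<lambda>i. w i * (- 1 / v i)) x = - csum v (\<lambda>i. w i / v i) x"
    by (simp add: csum_def sum_negf)
  ultimately show ?thesis by simp
qed

lemma bounded_csum_div:
  assumes w: "\<And>i. 0 \<le> w i" and lim: "((\<lambda>x. csum v w x / x) \<longlongrightarrow> l) at_top"
  obtains B where "\<And>t. \<bar>csum v w t / t\<bar> \<le> B"
proof (rule bounded_if_tendsto_at_top[OF lim])
  fix X
  \<comment> \<open>Below 1 the sum is empty, which also settles \<open>t \<le> 0\<close>; from 1
    on, dividing by \<open>t\<close> only decreases the value.\<close>
  have "\<bar>csum v w t / t\<bar> \<le> csum v w X" if "t \<le> X" for t
  proof (cases "t < 1")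
    case False
    then have "\<bar>csum v w t / t\<bar> \<le> csum v w t"
      using csum_nonneg[of w t, OF w] by (simp add: divide_le_eq mult_left_le mult_le_cancel_left1)
    also have "\<dots> \<le> csum v w X" using w that by (rule csum_mono)
    finally show ?thesis .
  qed (simp add: csum_eq_0 csum_nonneg w)
  then show "\<exists>B. \<forall>t\<le>X. \<bar>csum v w t / t\<bar> \<le> B" by blast
qed (use that in blast)

text \<open>Subtract \<open>csum_div_parts\<close> at \<open>x\<close> from the same identity at
  \<open>b * x\<close> and substitute \<open>t = x * s\<close>. The two boundary terms both tend to
  1 and cancel, while the integral tends to that of \<open>1 / s\<close> over
  \<open>{1<..b}\<close>. For the weights \<Lambda> this is all that the PNT contributes.\<close>

lemma csum_div_diff_tendsto:
  assumes w: "\<And>i. 0 \<le> w i" and lim: "((\<lambda>x. csum v w x / x) \<longlongrightarrow> 1) at_top" and b: "1 \<le> b"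
  shows "((\<lambda>x. csum v (\<lambda>i. w i / v i) (b * x) - csum v (\<lambda>i. w i / v i) x) \<longlongrightarrow> ln b) at_top"
proof -
  note [measurable] = csum_measurable[of w, OF w]
  obtain B where B: "\<And>t. \<bar>csum v w t / t\<bar> \<le> B" using bounded_csum_div[of w, OF w lim] by blast
  have eq: "csum v w (b * x) / (b * x) - csum v w x / x +
       (LINT s|lborel. csum v w (x * s) / (x * s) * (1 / s * indicator {1<..b} s))
     = csum v (\<lambda>i. w i / v i) (b * x) - csum v (\<lambda>i. w i / v i) x" if "1 \<le> x" for x
  proof -
    have x_le: "x \<le> b * x" using that b by simp
    have "has_bochner_integral lborel (\<lambda>t. csum v w t / t\<^sup>2 * indicator {1..b*x} t -
        csum v w t / t\<^sup>2 * indicator {1..x} t)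
      ((csum v (\<lambda>i. w i / v i) (b * x) - csum v w (b * x) / (b * x)) -
      (csum v (\<lambda>i. w i / v i) x - csum v w x / x))"
      by (intro has_bochner_integral_diff csum_div_parts)
    also have "(\<lambda>t. csum v w t / t\<^sup>2 * indicator {1..b*x} t -
        csum v w t / t\<^sup>2 * indicator {1..x} t) = (\<lambda>t. csum v w t / t\<^sup>2 * indicator {x<..b*x} t)"
      using that order_trans[OF _ x_le] by (auto simp: fun_eq_iff indicator_def)
    finally have "has_bochner_integral lborel
      (\<lambda>s. x * (csum v w (x * s) / (x * s)\<^sup>2 * indicator {x<..b*x} (x * s)))
      ((csum v (\<lambda>i. w i / v i) (b * x) - csum v w (b * x) / (b * x)) -
      (csum v (\<lambda>i. w i / v i) x - csum v w x / x))" (is "has_bochner_integral _ ?f ?I")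
      using that by (intro has_bochner_integral_scale) auto
    moreover have "?f = (\<lambda>s. csum v w (x * s) / (x * s) * (1 / s * indicator {1<..b} s))"
      using that by (auto simp: fun_eq_iff indicator_def power2_eq_square)
    ultimately have "(LINT s|lborel. csum v w (x * s) / (x * s) * (1 / s * indicator {1<..b} s)) = ?I"
      by (simp add: has_bochner_integral_integral_eq)
    then show ?thesis by simp
  qed
  have "((\<lambda>x. csum v w (b * x) / (b * x)) \<longlongrightarrow> 1) at_top"
    using b by (intro filterlim_compose[OF lim] filterlim_tendsto_pos_mult_at_top[OF tendsto_const]
      filterlim_ident) auto
  then have "((\<lambda>x. csum v w (b * x) / (b * x) - csum v w x / x +
       (LINT s|lborel. csum v w (x * s) / (x * s) * (1 / s * indicator {1<..b} s)))
     \<longlongrightarrow> 1 - 1 + 1 * (LINT s|lborel. 1 / s * indicator {1<..b} s)) at_top"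
    using has_bochner_integral_inverse_Ioc[OF b] B
    by (intro tendsto_add tendsto_diff lim tendsto_integral_scaled[where B=B])
      (auto simp: has_bochner_integral_iff indicator_def split: if_splits)
  then have "((\<lambda>x. csum v w (b * x) / (b * x) - csum v w x / x +
       (LINT s|lborel. csum v w (x * s) / (x * s) * (1 / s * indicator {1<..b} s)))
     \<longlongrightarrow> ln b) at_top"
    using has_bochner_integral_inverse_Ioc[OF b] by (simp add: has_bochner_integral_iff)
  then show ?thesis
    by (rule Lim_transform_eventually) (use eq in \<open>auto intro: eventually_at_top_linorderI[of 1]\<close>)
qed

text \<open>Writing \<open>a * ln x\<close> as an integral of \<open>a / t\<close>,
  \<open>csum_div_parts\<close> turns the difference into N(x)/x plus the integral of
  \<open>E(t)/t\<^sup>2\<close> over \<open>{1..x}\<close>. The first term yields \<open>a\<close>,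
  the second the full integral by absolute convergence.\<close>

lemma csum_inverse_tendsto:
  assumes N: "((\<lambda>x. csum v (\<lambda>_. 1) x / x) \<longlongrightarrow> a) at_top"
    and int: "integrable lborel (\<lambda>t. (csum v (\<lambda>_. 1) t - a * t) / t\<^sup>2 * indicator {1..} t)"
  shows "((\<lambda>x. csum v (\<lambda>i. 1 / v i) x - a * ln x) \<longlongrightarrow>
    a + (LINT t|lborel. (csum v (\<lambda>_. 1) t - a * t) / t\<^sup>2 * indicator {1..} t)) at_top"
proof -
  note [measurable] = csum_measurable[of "\<lambda>_. 1", simplified]
  define k where "k t = (csum v (\<lambda>_. 1) t - a * t) / t\<^sup>2 * indicator {1..} t" for t
  have eq: "csum v (\<lambda>_. 1) x / x + (LINT t|lborel. k t * indicator {..x} t) =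
    csum v (\<lambda>i. 1 / v i) x - a * ln x" if "1 \<le> x" for x
  proof -
    have "has_bochner_integral lborel (\<lambda>t. csum v (\<lambda>_. 1) t / t\<^sup>2 * indicator {1..x} t -
        a * (1 / t * indicator {1..x} t))
      (csum v (\<lambda>i. 1 / v i) x - csum v (\<lambda>_. 1) x / x - a * ln x)"
      by (intro has_bochner_integral_diff has_bochner_integral_mult_right csum_div_parts
          has_bochner_integral_inverse_Icc that)
    also have "(\<lambda>t. csum v (\<lambda>_. 1) t / t\<^sup>2 * indicator {1..x} t - a * (1 / t * indicator {1..x} t)) =
      (\<lambda>t. k t * indicator {..x} t)"
      by (auto simp: fun_eq_iff k_def indicator_def power2_eq_square field_simps)
    finally show ?thesis by (simp add: has_bochner_integral_integral_eq)
  qed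
  have "((\<lambda>x. LINT t|lborel. k t * indicator {..x} t) \<longlongrightarrow> (LINT t|lborel. k t)) at_top"
  proof (rule integral_dominated_convergence_at_top[where w = "\<lambda>t. \<bar>k t\<bar>"])
    show "integrable lborel (\<lambda>t. \<bar>k t\<bar>)" using integrable_abs[OF int] by (simp only: k_def)
    have "((\<lambda>x. k t * indicator {..x} t) \<longlongrightarrow> k t) at_top" for t
      by (rule tendsto_eventually) (auto intro!: eventually_at_top_linorderI[of t])
    then show "AE t in lborel. ((\<lambda>x. k t * indicator {..x} t) \<longlongrightarrow> k t) at_top" by simp
  qed (auto simp: k_def indicator_def)
  then have "((\<lambda>x. csum v (\<lambda>_. 1) x / x + (LINT t|lborel. k t * indicator {..x} t)) \<longlongrightarrow>
      a + (LINT t|lborel. k t)) at_top"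
    by (intro tendsto_add N)
  then show ?thesis unfolding k_def[symmetric]
    by (rule Lim_transform_eventually) (use eq in \<open>auto intro: eventually_at_top_linorderI[of 1]\<close>)
qed

text \<open>Partial summation with \<open>G = ln\<close> leaves E(x) log x / x, the term
  \<open>a / x\<close> coming from the lower endpoint of the integral of \<open>a\<close> over
  \<open>{1..x}\<close>, and minus (1/x) times the integral of N(t)/t - a over
  \<open>{1..x}\<close>. The last is a mean of a function tending to 0.\<close>

lemma csum_ln_asymp:
  assumes E: "((\<lambda>x. (csum v (\<lambda>_. 1) x - a * x) * ln x / x) \<longlongrightarrow> 0) at_top"
    and N: "((\<lambda>x. csum v (\<lambda>_. 1) x / x) \<longlongrightarrow> a) at_top"
  shows "((\<lambda>x. csum v (\<lambda>i. ln (v i)) x / x - a * ln x + a) \<longlongrightarrow> 0) at_top"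
proof -
  note [measurable] = csum_measurable[of "\<lambda>_. 1", simplified]
  obtain B where B: "\<And>t. \<bar>csum v (\<lambda>_. 1) t / t\<bar> \<le> B"
    using bounded_csum_div[of "\<lambda>_. 1" a] N by auto
  \<comment> \<open>Cutting off below 1 makes \<open>g\<close> bounded on the whole line and lets
    the mean over \<open>{1..x}\<close> become an integral over the fixed interval
    \<open>{0<..1}\<close> after scaling.\<close>
  define g where "g t = (csum v (\<lambda>_. 1) t / t - a) * indicator {1..} t" for t
  have [measurable]: "g \<in> borel_measurable borel" unfolding g_def by measurable
  have g_bound: "\<bar>g t\<bar> \<le> B + \<bar>a\<bar>" for t
  proof -
    have "\<bar>csum v (\<lambda>_. 1) t / t - a\<bar> \<le> B + \<bar>a\<bar>" using B[of t] by linarith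
    moreover have "0 \<le> B + \<bar>a\<bar>" using B[of t] by linarith
    ultimately show ?thesis by (auto simp: g_def indicator_def)
  qed
  have "((\<lambda>t. csum v (\<lambda>_. 1) t / t - a) \<longlongrightarrow> a - a) at_top" by (intro tendsto_intros N)
  then have "((\<lambda>t. csum v (\<lambda>_. 1) t / t - a) \<longlongrightarrow> 0) at_top" by simp
  then have g_lim: "(g \<longlongrightarrow> 0) at_top"
    by (rule Lim_transform_eventually)
      (auto simp: g_def intro!: eventually_at_top_linorderI[of 1])
  have eq: "(csum v (\<lambda>_. 1) x - a * x) * ln x / x + a / x
      - (LINT s|lborel. g (x * s) * indicator {0<..1} s)
    = csum v (\<lambda>i. ln (v i)) x / x - a * ln x + a" if x: "1 \<le> x" for x
  proof -
    let ?I = "csum v (\<lambda>_. 1) x * ln x - csum v (\<lambda>i. ln (v i)) x - (a * x - a * 1)"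
    have "has_bochner_integral lborel (\<lambda>t. csum v (\<lambda>_. 1) t * (1 / t) * indicator {1..x} t)
        (csum v (\<lambda>_. 1) x * ln x - csum v (\<lambda>i. 1 * ln (v i)) x)"
      by (rule partial_summation) (auto intro!: derivative_eq_intros continuous_intros)
    moreover have "has_bochner_integral lborel (\<lambda>t. a * indicator {1..x} t) (a * x - a * 1)"
      using x by (intro has_bochner_integral_FTC_Icc_real) (auto intro!: derivative_eq_intros)
    ultimately have "has_bochner_integral lborel
      (\<lambda>t. csum v (\<lambda>_. 1) t * (1 / t) * indicator {1..x} t - a * indicator {1..x} t) ?I"
      by (auto dest: has_bochner_integral_diff)
    also have "(\<lambda>t. csum v (\<lambda>_. 1) t * (1 / t) * indicator {1..x} t - a * indicator {1..x} t) =
        (\<lambda>t. g t * indicator {..x} t)"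
      by (auto simp: fun_eq_iff g_def indicator_def)
    finally have "has_bochner_integral lborel (\<lambda>s. x * (g (x * s) * indicator {..x} (x * s))) ?I"
      using x by (intro has_bochner_integral_scale) auto
    moreover have "g (x * s) * indicator {..x} (x * s) = g (x * s) * indicator {0<..1} s" for s
    proof (cases "0 < s")
      case False
      then have "x * s \<le> 0" using x by (simp add: mult_nonneg_nonpos)
      then show ?thesis using False by (simp add: g_def)
    qed (use x in \<open>auto simp: indicator_def mult_le_cancel_left1\<close>)
    ultimately have "has_bochner_integral lborel (\<lambda>s. x * (g (x * s) * indicator {0<..1} s)) ?I"
      by (simp only:)
    then have "x * (LINT s|lborel. g (x * s) * indicator {0<..1} s) = ?I"
      using has_bochner_integral_integral_eq by fastforce
    then have "(LINT s|lborel. g (x * s) * indicator {0<..1} s) = ?I / x"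
      using x by (simp add: field_simps)
    then show ?thesis using x by (simp add: field_simps)
  qed
  have ax: "((\<lambda>x. a / x) \<longlongrightarrow> 0) at_top"
    by (intro tendsto_divide_0[OF tendsto_const] filterlim_at_top_imp_at_infinity filterlim_ident)
  have "((\<lambda>x. LINT s|lborel. g (x * s) * indicator {0<..1} s) \<longlongrightarrow>
      0 * (LINT s|lborel. indicator {0<..1::real} s)) at_top"
    by (rule tendsto_integral_scaled[where B = "B + \<bar>a\<bar>"])
      (auto simp: g_lim g_bound split: split_indicator_asm)
  then have "((\<lambda>x. (csum v (\<lambda>_. 1) x - a * x) * ln x / x + a / x
      - (LINT s|lborel. g (x * s) * indicator {0<..1} s)) \<longlongrightarrow> 0 + 0 - 0) at_top"
    by (intro tendsto_add tendsto_diff E ax) simp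
  then have "((\<lambda>x. (csum v (\<lambda>_. 1) x - a * x) * ln x / x + a / x
      - (LINT s|lborel. g (x * s) * indicator {0<..1} s)) \<longlongrightarrow> 0) at_top" by simp
  then show ?thesis
    by (rule Lim_transform_eventually) (use eq in \<open>auto intro: eventually_at_top_linorderI[of 1]\<close>)
qed

section \<open>The averaged Chebyshev identity and the asymptotics it yields\<close>

text \<open>For the \<open>i\<close>-th term substitute \<open>u = X * t / v i\<close>. The window
  for \<open>t\<close> becomes \<open>X / v i < u \<le> b * X / v i\<close>, which for fixed
  \<open>u\<close> says \<open>X / u < v i \<le> b * X / u\<close>. Summing over \<open>i\<close>
  first therefore produces a difference of \<open>csum v (\<lambda>i. w i / v i)\<close>, integrated
  against \<open>E(u)/u\<^sup>2\<close>.\<close>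

lemma averaged_convolution:
  assumes hyp: "\<And>x. csum v (\<lambda>i. ln (v i)) x = (\<Sum>i | v i \<le> x. w i * csum v (\<lambda>_. 1) (x / v i))"
    and int: "integrable lborel (\<lambda>t. (csum v (\<lambda>_. 1) t - a * t) / t\<^sup>2 * indicator {1..} t)"
    and X: "0 < X" and b: "1 \<le> b"
  shows "has_bochner_integral lborel
    (\<lambda>t. (csum v (\<lambda>i. ln (v i)) (X * t) / (X * t) - a * csum v (\<lambda>i. w i / v i) (X * t)) / t
         * indicator {1<..b} t)
    (LINT u|lborel. (csum v (\<lambda>i. w i / v i) (b * (X * (1 / u))) - csum v (\<lambda>i. w i / v i) (X * (1 / u)))
         * ((csum v (\<lambda>_. 1) u - a * u) / u\<^sup>2 * indicator {1..} u))"
proof -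
  define k where "k t = (csum v (\<lambda>_. 1) t - a * t) / t\<^sup>2 * indicator {1..} t" for t
  \<comment> \<open>Larger \<open>v i\<close> contribute nothing: the cutoff
    \<open>u \<ge> 1\<close> in \<open>k\<close> forces
    \<open>v i \<le> b * X / u \<le> b * X\<close>.\<close>
  define I where "I = {i. v i \<le> b * X}"
  have v_pos: "0 < v i" for i using ge_1[of i] by linarith
  define G where "G i u = w i / v i * (k u * indicator {X / v i<..b * (X / v i)} u)" for i u
  define J where "J i = (LINT u|lborel. G i u)" for i
  have G: "has_bochner_integral lborel (G i) (J i)" for i
    unfolding J_def
  proof (rule has_bochner_integral_integrable)
    show "integrable lborel (G i)"
      unfolding G_def using int
      by (intro integrable_mult_right integrable_real_mult_indicator) (simp_all add: k_def)
  qed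
  have "has_bochner_integral lborel (\<lambda>t. \<Sum>i\<in>I. X / v i * G i (X / v i * t)) (\<Sum>i\<in>I. J i)"
    using X v_pos by (intro has_bochner_integral_sum has_bochner_integral_scale G) auto
  also have "(\<lambda>t. \<Sum>i\<in>I. X / v i * G i (X / v i * t)) =
    (\<lambda>t. (csum v (\<lambda>i. ln (v i)) (X * t) / (X * t) - a * csum v (\<lambda>i. w i / v i) (X * t)) / t
         * indicator {1<..b} t)"
  proof
    fix t
    show "(\<Sum>i\<in>I. X / v i * G i (X / v i * t)) =
      (csum v (\<lambda>i. ln (v i)) (X * t) / (X * t) - a * csum v (\<lambda>i. w i / v i) (X * t)) / t
         * indicator {1<..b} t"
    proof (cases "t \<in> {1<..b}")
      case False
      then have "indicator {X / v i<..b * (X / v i)} (X / v i * t) = (0::real)" for i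
        using X v_pos[of i] by (auto simp: indicator_def field_simps)
      then show ?thesis using False by (simp add: G_def)
    next
      case True
      then have Xt: "0 < X * t" "X * t \<le> b * X" "0 < t" using X by auto
      \<comment> \<open>The cutoff in \<open>k\<close> at \<open>u = X / v i * t\<close> is exactly
        the summation range \<open>v i \<le> X * t\<close> of the convolution.\<close>
      have "X / v i * G i (X / v i * t) = (if v i \<le> X * t then
          (w i * csum v (\<lambda>_. 1) (X * t / v i) / (X * t) - a * (w i / v i)) / t else 0)" for i
      proof -
        have "indicator {X / v i<..b * (X / v i)} (X / v i * t) = (1::real)"
          using X v_pos[of i] True by (auto simp: indicator_def field_simps)
        moreover have "1 \<le> X / v i * t \<longleftrightarrow> v i \<le> X * t"
          using v_pos[of i] by (simp add: field_simps)
        ultimately show ?thesis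
          using X v_pos[of i] Xt
          by (auto simp: G_def k_def indicator_def power2_eq_square field_simps)
      qed
      then have "(\<Sum>i\<in>I. X / v i * G i (X / v i * t)) =
        csum v (\<lambda>i. (w i * csum v (\<lambda>_. 1) (X * t / v i) / (X * t) - a * (w i / v i)) / t) (X * t)"
        by (simp only: csum_extend[OF Xt(2)] I_def)
      also have "\<dots> = (csum v (\<lambda>i. ln (v i)) (X * t) / (X * t) - a * csum v (\<lambda>i. w i / v i) (X * t)) / t"
        unfolding hyp
        by (simp add: csum_def sum_divide_distrib sum_subtractf sum_distrib_left diff_divide_distrib)
      finally show ?thesis using True by simp
    qed
  qed
  also have "(\<Sum>i\<in>I. J i) = (LINT u|lborel. (\<Sum>i\<in>I. G i u))"
    by (intro has_bochner_integral_integral_eq[symmetric] has_bochner_integral_sum G)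
  also have "\<dots> = (LINT u|lborel. (csum v (\<lambda>i. w i / v i) (b * (X * (1 / u))) - csum v (\<lambda>i. w i / v i) (X * (1 / u))) * k u)"
  proof (rule Bochner_Integration.integral_cong[OF refl])
    fix u
    show "(\<Sum>i\<in>I. G i u) =
      (csum v (\<lambda>i. w i / v i) (b * (X * (1 / u))) - csum v (\<lambda>i. w i / v i) (X * (1 / u))) * k u"
    proof (cases "1 \<le> u")
      case False
      then show ?thesis by (simp add: G_def k_def)
    next
      case True
      have "X * (1 / u) \<le> X * 1" using True X by (intro mult_left_mono) auto
      moreover have X_le: "X \<le> b * X" using X b by simp
      ultimately have bX: "X * (1 / u) \<le> b * X" by linarith
      have bX': "b * (X * (1 / u)) \<le> b * X"
        using \<open>X * (1 / u) \<le> X * 1\<close> b by (intro mult_left_mono) auto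
      \<comment> \<open>The condition on \<open>u\<close> is now read as a condition on
        \<open>v i\<close>, as a difference of two initial segments.\<close>
      have "(\<Sum>i\<in>I. G i u) = (\<Sum>i\<in>I. ((if v i \<le> b * (X * (1 / u)) then w i / v i else 0) -
          (if v i \<le> X * (1 / u) then w i / v i else 0)) * k u)"
        using True v_pos order_trans[OF _ X_le]
        by (intro sum.cong) (auto simp: G_def indicator_def field_simps)
      then show ?thesis
        by (simp only: csum_extend[OF bX] csum_extend[OF bX'] I_def sum_subtractf
            sum_distrib_right[symmetric])
    qed
  qed
  finally show ?thesis unfolding k_def .
qed

text \<open>The average of S(x)/x - a M(x) over the window starting at \<open>X\<close> is
  \<open>C X\<close> by the convolution identity, and \<open>a * ln X - a - a * M X\<close> up to
  the integral of \<open>R X\<close>. Since \<open>C X\<close> converges to the integral of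
  \<open>k\<close> and the error vanishes, solving for \<open>M X - ln X\<close> gives the
  constant.\<close>

lemma csum_mangoldt_asymp:
  assumes w: "\<And>i. 0 \<le> w i" and psi: "((\<lambda>x. csum v w x / x) \<longlongrightarrow> 1) at_top"
    and hyp: "\<And>x. csum v (\<lambda>i. ln (v i)) x = (\<Sum>i | v i \<le> x. w i * csum v (\<lambda>_. 1) (x / v i))"
    and E: "((\<lambda>x. (csum v (\<lambda>_. 1) x - a * x) * ln x / x) \<longlongrightarrow> 0) at_top"
    and N: "((\<lambda>x. csum v (\<lambda>_. 1) x / x) \<longlongrightarrow> a) at_top"
    and int: "integrable lborel (\<lambda>t. (csum v (\<lambda>_. 1) t - a * t) / t\<^sup>2 * indicator {1..} t)"
    and a: "0 < a"
  shows "((\<lambda>x. csum v (\<lambda>i. w i / v i) x - ln x) \<longlongrightarrow>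
    - 1 - 1 / a * (LINT t|lborel. (csum v (\<lambda>_. 1) t - a * t) / t\<^sup>2 * indicator {1..} t)) at_top"
proof -
  define k where "k t = (csum v (\<lambda>_. 1) t - a * t) / t\<^sup>2 * indicator {1..} t" for t
  define S where "S = csum v (\<lambda>i. ln (v i))"
  define M where "M = csum v (\<lambda>i. w i / v i)"
  \<comment> \<open>With b = e the measure dt/t gives the window total mass \<open>ln b = 1\<close>,
    so the average needs no normalization.\<close>
  define b :: real where "b = exp 1"
  have b: "1 \<le> b" "ln b = 1" by (auto simp: b_def)
  define D where "D x = M (b * x) - M x" for x
  define r where "r x = S x / x - a * ln x + a" for x
  \<comment> \<open>The error of replacing \<open>S (X * t) / (X * t)\<close> by
    \<open>a * ln (X * t) - a\<close> and \<open>M (X * t)\<close> by \<open>M X + ln t\<close>; the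
    two contributions \<open>a * ln t\<close> cancel.\<close>
  define R where "R X t = (r (X * t) - a * (M (X * t) - M X - ln t)) * (1 / t * indicator {1<..b} t)" for X t
  have wv: "0 \<le> w i / v i" and lnv: "0 \<le> ln (v i)" for i using w[of i] ge_1[of i] by auto
  have M_mono: "M x \<le> M y" if "x \<le> y" for x y unfolding M_def by (rule csum_mono[OF wv that])
  have M_nonneg: "0 \<le> M x" for x unfolding M_def by (rule csum_nonneg[OF wv])
  have [measurable]: "M \<in> borel_measurable borel" "S \<in> borel_measurable borel"
    unfolding M_def S_def by (rule csum_measurable, rule wv, rule csum_measurable, rule lnv)
  have [measurable]: "D \<in> borel_measurable borel" "r \<in> borel_measurable borel"
    unfolding D_def r_def by measurable
  have M_diff: "((\<lambda>x. M (t * x) - M x) \<longlongrightarrow> ln t) at_top" if "1 \<le> t" for t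
    unfolding M_def using w psi that by (rule csum_div_diff_tendsto)
  have D_lim: "(D \<longlongrightarrow> 1) at_top" unfolding D_def using M_diff[OF b(1)] b(2) by simp
  have r_lim: "(r \<longlongrightarrow> 0) at_top" unfolding r_def S_def by (rule csum_ln_asymp[OF E N])
  obtain B where B: "\<And>t. \<bar>D t\<bar> \<le> B"
  proof (rule bounded_if_tendsto_at_top[OF D_lim])
    fix X
    \<comment> \<open>\<open>M\<close> is nonnegative and monotone, so both terms of
      \<open>D t\<close> are controlled by their values at \<open>X\<close>.\<close>
    have "\<bar>D t\<bar> \<le> M (b * X) + M X" if "t \<le> X" for t
      using M_mono[OF that] M_mono[of "b * t" "b * X"] that b M_nonneg[of t] M_nonneg[of "b * t"]
      by (auto simp: D_def)
    then show "\<exists>B. \<forall>t\<le>X. \<bar>D t\<bar> \<le> B" by blast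
  qed blast
  define C where "C X = (LINT u|lborel. D (X * (1 / u)) * k u)" for X
  have C_lim: "(C \<longlongrightarrow> 1 * (LINT u|lborel. k u)) at_top"
    unfolding C_def using int D_lim B
    by (intro tendsto_integral_scaled[where B = B]) (auto simp: k_def indicator_def split: if_splits)
  have eq: "(C X - (LINT t|lborel. R X t)) = a * ln X - a - a * M X" if "0 < X" for X
  proof -
    have "has_bochner_integral lborel
      (\<lambda>t. (S (X * t) / (X * t) - a * M (X * t)) / t * indicator {1<..b} t) (C X)"
      unfolding S_def M_def C_def D_def k_def by (rule averaged_convolution[OF hyp int that b(1)])
    moreover have "has_bochner_integral lborel
      (\<lambda>t. (a * ln X - a - a * M X) * (1 / t * indicator {1<..b} t)) ((a * ln X - a - a * M X) * ln b)"
      by (intro has_bochner_integral_mult_right has_bochner_integral_inverse_Ioc b)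
    ultimately have "has_bochner_integral lborel
      (\<lambda>t. (S (X * t) / (X * t) - a * M (X * t)) / t * indicator {1<..b} t
         - (a * ln X - a - a * M X) * (1 / t * indicator {1<..b} t)) (C X - (a * ln X - a - a * M X) * ln b)"
      by (rule has_bochner_integral_diff)
    also have "(\<lambda>t. (S (X * t) / (X * t) - a * M (X * t)) / t * indicator {1<..b} t
         - (a * ln X - a - a * M X) * (1 / t * indicator {1<..b} t)) = R X"
      using that by (auto simp: fun_eq_iff R_def r_def indicator_def ln_mult algebra_simps
        diff_divide_distrib add_divide_distrib)
    finally show ?thesis using b by (simp add: has_bochner_integral_integral_eq)
  qed
  have "((\<lambda>X. LINT t|lborel. R X t) \<longlongrightarrow> (LINT (t::real)|lborel. 0)) at_top"
  proof (rule integral_dominated_convergence_at_top)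
    show "integrable lborel (\<lambda>t. (1 + a * 3) * (1 / t * indicator {1<..b} t))"
      using has_bochner_integral_inverse_Ioc[OF b(1)]
      by (intro integrable_mult_right) (auto simp: has_bochner_integral_iff)
    have "((\<lambda>X. R X t) \<longlongrightarrow> 0) at_top" for t
    proof (cases "t \<in> {1<..b}")
      case True
      have "((\<lambda>X. r (X * t)) \<longlongrightarrow> 0) at_top"
        using True filterlim_tendsto_pos_mult_at_top[OF tendsto_const _ filterlim_ident, of t]
        by (intro filterlim_compose[OF r_lim]) (auto simp: mult.commute)
      moreover have "((\<lambda>X. M (X * t) - M X) \<longlongrightarrow> ln t) at_top"
        using M_diff[of t] True by (simp add: mult.commute)
      ultimately have "((\<lambda>X. R X t) \<longlongrightarrow>
          (0 - a * (ln t - ln t)) * (1 / t * indicator {1<..b} t)) at_top"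
        unfolding R_def by (intro tendsto_intros)
      then show ?thesis by simp
    qed (simp add: R_def)
    then show "AE t in lborel. ((\<lambda>X. R X t) \<longlongrightarrow> 0) at_top" by simp
    obtain X0 where X0: "\<And>x. x \<ge> X0 \<Longrightarrow> \<bar>r x\<bar> < 1 \<and> \<bar>D x - 1\<bar> < 1"
      using eventually_conj[OF tendstoD[OF r_lim, of 1] tendstoD[OF D_lim, of 1]]
      unfolding eventually_at_top_linorder by (auto simp: dist_real_def)
    \<comment> \<open>The 1 bounds \<open>r\<close>. Monotonicity of \<open>M\<close> gives
      \<open>0 \<le> M (X * t) - M X \<le> D X < 2\<close> uniformly in \<open>t\<close>, and
      \<open>0 \<le> ln t \<le> 1\<close>, whence the 3.\<close>
    have "\<bar>R X t\<bar> \<le> (1 + a * 3) * (1 / t * indicator {1<..b} t)" if X: "X \<ge> max 1 X0" for X t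
    proof (cases "t \<in> {1<..b}")
      case True
      then have Xt: "X \<le> X * t" "X * t \<le> b * X" using X by (auto simp: mult_le_cancel_left1)
      have "\<bar>r (X * t)\<bar> \<le> 1" using X0[of "X * t"] X Xt(1) by linarith
      moreover have "0 \<le> ln t" "ln t \<le> 1"
        using True b ln_mono[of t b] by auto
      then have "\<bar>M (X * t) - M X - ln t\<bar> \<le> 3"
        using M_mono[OF Xt(1)] M_mono[OF Xt(2)] X0[of X] X by (auto simp: D_def)
      then have "\<bar>a * (M (X * t) - M X - ln t)\<bar> \<le> a * 3"
        using a by (simp add: abs_mult)
      ultimately have "\<bar>r (X * t) - a * (M (X * t) - M X - ln t)\<bar> \<le> 1 + a * 3"
        by linarith
      then show ?thesis using True by (simp add: R_def abs_mult divide_right_mono)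
    qed (simp add: R_def)
    then show "\<forall>\<^sub>F X in at_top. AE t in lborel. norm (R X t) \<le> (1 + a * 3) * (1 / t * indicator {1<..b} t)"
      by (intro eventually_at_top_linorderI[of "max 1 X0"]) auto
  qed (auto simp: R_def)
  then have "((\<lambda>X. - 1 - 1 / a * (C X - (LINT t|lborel. R X t))) \<longlongrightarrow>
      - 1 - 1 / a * (1 * (LINT u|lborel. k u) - (LINT (t::real)|lborel. 0))) at_top"
    by (intro tendsto_intros C_lim)
  then have "((\<lambda>X. - 1 - 1 / a * (C X - (LINT t|lborel. R X t))) \<longlongrightarrow>
      - 1 - 1 / a * (LINT u|lborel. k u)) at_top" by simp
  then show ?thesis unfolding k_def[symmetric] M_def[symmetric]
  proof (rule Lim_transform_eventually)
    have "- 1 - 1 / a * (C X - (LINT t|lborel. R X t)) = M X - ln X" if "0 < X" for X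
      unfolding eq[OF that] using a by (simp add: field_simps)
    then show "\<forall>\<^sub>F X in at_top. - 1 - 1 / a * (C X - (LINT t|lborel. R X t)) = M X - ln X"
      by (auto intro: eventually_at_top_linorderI[of 1])
  qed
qed

end


section \<open>Chebyshev's identity for formal products\<close>

lemma counting_formal_value:
  assumes "beurling_primes p" shows "counting (formal_value p)"
  by unfold_locales (rule formal_value_ge_1[OF assms], rule finite_formal_value_le[OF assms])

text \<open>Reindexing along the bijection \<open>e\<close> replaces the listing by sums over formal
  products, where divisibility is available as inclusion of multisets.\<close>

lemma sum_gint_eq_csum:
  assumes "gint_listing p e"
  shows "(\<Sum>k | gint p e k \<le> x. w (e k)) = csum (formal_value p) w x"
proof -
  have "bij e" using assms by (simp add: gint_listing_def)
  then have "bij_betw e {k. gint p e k \<le> x} {M. formal_value p M \<le> x}"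
    by (auto simp: bij_betw_def gint_def inj_on_def bij_def surj_def image_iff)
  from sum.reindex_bij_betw[OF this, of w] show ?thesis by (simp only: csum_def)
qed

lemma formal_mangoldt_nonneg:
  assumes "beurling_primes p" shows "0 \<le> formal_mangoldt p M"
proof (cases "\<exists>j m. 0 < m \<and> M = replicate_mset m j")
  case True
  then show ?thesis
    using beurling_primes_gt_1(1)[OF assms] by (auto simp: formal_mangoldt_prime_power less_imp_le)
qed (simp only: formal_mangoldt_def if_False order_refl)

lemma formal_value_union: "formal_value p (P + Q) = formal_value p P * formal_value p Q"
  by (simp add: formal_value_def)

lemma finite_submultisets:
  fixes M :: "'a multiset"
  shows "finite {P. P \<subseteq># M}"
proof (induction M)
  case (add x M)
  have "{P. P \<subseteq># add_mset x M} \<subseteq> {P. P \<subseteq># M} \<union> add_mset x ` {P. P \<subseteq># M}"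
  proof
    fix P assume "P \<in> {P. P \<subseteq># add_mset x M}"
    then have "P - {#x#} \<subseteq># M" by (simp add: subset_eq_diff_conv)
    moreover have "P = add_mset x (P - {#x#}) \<or> P = P - {#x#}"
      by (cases "x \<in># P") (simp_all add: diff_single_trivial)
    ultimately show "P \<in> {P. P \<subseteq># M} \<union> add_mset x ` {P. P \<subseteq># M}" by auto
  qed
  then show ?case by (rule finite_subset) (simp add: add.IH)
qed simp

text \<open>The identity log n = \<Sum> \<Lambda>(d) over the divisors d of n. Only submultisets
  consisting of copies of one index \<open>j\<close> count, and there are \<open>count M j\<close>
  nonempty ones, each contributing \<open>ln (p j)\<close>.\<close>

lemma sum_formal_mangoldt_subseteq:
  assumes p: "beurling_primes p"
  shows "(\<Sum>P | P \<subseteq># M. formal_mangoldt p P) = ln (formal_value p M)"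
proof -
  have p_pos: "0 < p j" for j using beurling_primes_gt_1(1)[OF p, of j] by linarith
  \<comment> \<open>Starting at multiplicity 1 keeps the parametrization injective, since zero
    copies of any index give the same empty multiset.\<close>
  define A where "A = (SIGMA j:set_mset M. {1..count M j})"
  have "(\<Sum>P | P \<subseteq># M. formal_mangoldt p P) =
    (\<Sum>P\<in>(\<lambda>(j, m). replicate_mset m j) ` A. formal_mangoldt p P)"
  proof (rule sum.mono_neutral_right[OF finite_submultisets])
    show "(\<lambda>(j, m). replicate_mset m j) ` A \<subseteq> {P. P \<subseteq># M}"
      by (auto simp: A_def count_le_replicate_mset_subset_eq[symmetric])
    show "\<forall>P\<in>{P. P \<subseteq># M} - (\<lambda>(j, m). replicate_mset m j) ` A. formal_mangoldt p P = 0"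
    proof
      fix P assume P: "P \<in> {P. P \<subseteq># M} - (\<lambda>(j, m). replicate_mset m j) ` A"
      have "\<not> (\<exists>j m. 0 < m \<and> P = replicate_mset m j)"
      proof
        assume "\<exists>j m. 0 < m \<and> P = replicate_mset m j"
        then obtain j m where jm: "0 < m" "P = replicate_mset m j" by blast
        then have "m \<le> count M j" using P by (simp add: count_le_replicate_mset_subset_eq)
        moreover from this have "j \<in># M" using jm(1) count_greater_zero_iff[of M j] by linarith
        ultimately have "(j, m) \<in> A" using jm(1) by (simp add: A_def)
        then show False using P jm(2) by (auto simp: image_iff)
      qed
      then show "formal_mangoldt p P = 0" by (simp only: formal_mangoldt_def if_False)
    qed
  qed
  also have "\<dots> = (\<Sum>(j, m)\<in>A. ln (p j))"
  proof (subst sum.reindex)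
    show "inj_on (\<lambda>(j, m). replicate_mset m j) A"
      by (auto simp: inj_on_def A_def replicate_mset_eq_iff)
  qed (auto simp: A_def formal_mangoldt_prime_power intro!: sum.cong)
  also have "\<dots> = (\<Sum>j\<in>set_mset M. real (count M j) * ln (p j))"
    unfolding A_def by (subst sum.Sigma[symmetric]) auto
  also have "\<dots> = (\<Sum>j\<in>set_mset M. ln (p j ^ count M j))"
    by (intro sum.cong refl ln_realpow[symmetric] p_pos)
  also have "\<dots> = ln (\<Prod>j\<in>set_mset M. p j ^ count M j)"
    by (intro ln_prod[symmetric]) (simp_all add: p_pos p_pos[THEN less_imp_neq, symmetric])
  finally show ?thesis by (simp add: formal_value_def image_prod_mset_multiplicity)
qed

text \<open>Expand each logarithm over submultisets \<open>P\<close> of \<open>M\<close> and change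
  variables to \<open>M = P + Q\<close>. By multiplicativity the constraint becomes
  \<open>?v Q \<le> x / ?v P\<close>, so each \<open>P\<close> is counted N(x / \<open>?v P\<close>)
  times.\<close>

lemma csum_ln_eq_mangoldt_convolution:
  assumes p: "beurling_primes p"
  shows "csum (formal_value p) (\<lambda>M. ln (formal_value p M)) x =
    (\<Sum>P | formal_value p P \<le> x. formal_mangoldt p P * csum (formal_value p) (\<lambda>_. 1) (x / formal_value p P))"
proof -
  let ?v = "formal_value p"
  have v_pos: "0 < ?v P" for P using formal_value_ge_1[OF p, of P] by linarith
  note fin = finite_formal_value_le[OF p]
  have "csum ?v (\<lambda>M. ln (?v M)) x = (\<Sum>M | ?v M \<le> x. \<Sum>P | P \<subseteq># M. formal_mangoldt p P)"
    by (simp add: csum_def sum_formal_mangoldt_subseteq[OF p])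
  also have "\<dots> = (\<Sum>(M, P)\<in>(SIGMA M:{M. ?v M \<le> x}. {P. P \<subseteq># M}). formal_mangoldt p P)"
    by (rule sum.Sigma) (simp_all add: fin finite_submultisets)
  also have "\<dots> = (\<Sum>(P, Q)\<in>(SIGMA P:{P. ?v P \<le> x}. {Q. ?v Q \<le> x / ?v P}). formal_mangoldt p P)"
  proof (rule sum.reindex_bij_witness[where i = "\<lambda>(P, Q). (P + Q, P)" and j = "\<lambda>(M, P). (P, M - P)"])
    fix z assume "z \<in> (SIGMA M:{M. ?v M \<le> x}. {P. P \<subseteq># M})"
    then obtain P Q where z: "z = (P + Q, P)" "?v P * ?v Q \<le> x"
      by (auto simp: formal_value_union mset_subset_eq_exists_conv)
    \<comment> \<open>Values are at least 1, so a divisor of a product of value at most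
      \<open>x\<close> is itself in range.\<close>
    have "?v P * 1 \<le> ?v P * ?v Q"
      using v_pos[of P] formal_value_ge_1[OF p] by (intro mult_left_mono) auto
    then have "?v P \<le> x" using z(2) by linarith
    then show "(case z of (M, P) \<Rightarrow> (P, M - P)) \<in> (SIGMA P:{P. ?v P \<le> x}. {Q. ?v Q \<le> x / ?v P})"
      using z v_pos[of P] by (auto simp: field_simps)
  qed (auto simp: formal_value_union field_simps v_pos)
  also have "\<dots> = (\<Sum>P | ?v P \<le> x. formal_mangoldt p P * csum ?v (\<lambda>_. 1) (x / ?v P))"
    by (subst sum.Sigma[symmetric]) (simp_all add: fin csum_def mult.commute)
  finally show ?thesis .
qed

section \<open>Transfer to the listed generalized integers\<close>

theorem theorem1p1:
  fixes p :: "nat \<Rightarrow> real" and e :: "nat \<Rightarrow> nat multiset" and a :: real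
  assumes primes: "beurling_primes p"
    and listing: "gint_listing p e"
    and PNT: "gpsi p e \<sim>[at_top] (\<lambda>x. x)"
    and a_pos: "a > 0"
    and N_asymp: "(\<lambda>x. gN p e x - a * x) \<in> o[at_top](\<lambda>x. x / ln x)"
    and N_int: "(\<integral>\<^sup>+x\<in>{1..}. ennreal \<bar>(gN p e x - a * x) / x\<^sup>2\<bar> \<partial>lborel) < \<infinity>"
  shows "\<exists>L c. ((\<lambda>x. (\<Sum>k | gint p e k \<le> x. 1 / gint p e k) - a * ln x) \<longlongrightarrow> L) at_top
    \<and> (\<lambda>x. gpsi1 p e x - (ln x + c)) \<in> o[at_top](\<lambda>_. 1)
    \<and> c = - 1 - 1 / a * (LINT x:{1..}|lborel. (gN p e x - a * x) / x\<^sup>2)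
    \<and> c = - (1 / a) * L"
proof -
  let ?v = "formal_value p"
  interpret counting ?v by (rule counting_formal_value[OF primes])
  have N_eq: "gN p e = csum ?v (\<lambda>_. 1)"
    unfolding gN_def by (rule ext) (rule sum_gint_eq_csum[OF listing])
  have psi_eq: "gpsi p e = csum ?v (formal_mangoldt p)"
    unfolding gpsi_def gmangoldt_def by (rule ext) (rule sum_gint_eq_csum[OF listing])
  have psi1_eq: "gpsi1 p e = csum ?v (\<lambda>M. formal_mangoldt p M / ?v M)"
    unfolding gpsi1_def gmangoldt_def gint_def[of p e]
    by (rule ext) (rule sum_gint_eq_csum[OF listing, unfolded gint_def])
  have inverse_eq: "(\<Sum>k | gint p e k \<le> x. 1 / gint p e k) = csum ?v (\<lambda>M. 1 / ?v M) x" for x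
    unfolding gint_def[of p e] by (rule sum_gint_eq_csum[OF listing, unfolded gint_def])
  define k where "k t = (gN p e t - a * t) / t\<^sup>2 * indicator {1..} t" for t :: real
  define I where "I = (LINT t|lborel. k t)"
  have I_eq: "(LINT x:{1..}|lborel. (gN p e x - a * x) / x\<^sup>2) = I"
    by (simp add: set_lebesgue_integral_def I_def k_def mult.commute)
  have [measurable]: "gN p e \<in> borel_measurable borel"
    unfolding N_eq by (rule csum_measurable) simp
  have int: "integrable lborel k"
  proof (rule integrableI_bounded)
    show "k \<in> borel_measurable lborel" unfolding k_def by measurable
    have "(\<integral>\<^sup>+t. ennreal (norm (k t)) \<partial>lborel) =
        (\<integral>\<^sup>+x\<in>{1..}. ennreal \<bar>(gN p e x - a * x) / x\<^sup>2\<bar> \<partial>lborel)"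
      by (intro nn_integral_cong) (auto simp: k_def indicator_def)
    then show "(\<integral>\<^sup>+t. ennreal (norm (k t)) \<partial>lborel) < \<infinity>" using N_int by simp
  qed
  \<comment> \<open>The relation \<open>\<sim>\<close> uses a quotient that equals 1 where both
    functions vanish; for \<open>x \<ge> 1\<close> it is the ordinary quotient.\<close>
  have psi_lim: "((\<lambda>x. gpsi p e x / x) \<longlongrightarrow> 1) at_top"
    using asymp_equivD[OF PNT]
    by (rule Lim_transform_eventually) (auto intro: eventually_at_top_linorderI[of 1])
  have E_lim: "((\<lambda>x. (gN p e x - a * x) * ln x / x) \<longlongrightarrow> 0) at_top"
    using smalloD_tendsto[OF N_asymp] by (simp add: field_simps)
  \<comment> \<open>This expression is N(x)/x once \<open>ln x\<close> is nonzero, hence the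
    threshold 2 below.\<close>
  have "((\<lambda>x. (gN p e x - a * x) * ln x / x * inverse (ln x) + a) \<longlongrightarrow> 0 * 0 + a) at_top"
    by (intro tendsto_intros E_lim tendsto_inverse_0_at_top ln_at_top)
  then have "((\<lambda>x. (gN p e x - a * x) * ln x / x * inverse (ln x) + a) \<longlongrightarrow> a) at_top" by simp
  then have N_lim: "((\<lambda>x. gN p e x / x) \<longlongrightarrow> a) at_top"
    by (rule Lim_transform_eventually)
      (auto intro!: eventually_at_top_linorderI[of 2] simp: field_simps)
  have L: "((\<lambda>x. (\<Sum>k | gint p e k \<le> x. 1 / gint p e k) - a * ln x) \<longlongrightarrow> a + I) at_top"
    unfolding inverse_eq I_def k_def N_eq
    by (rule csum_inverse_tendsto[OF N_lim[unfolded N_eq] int[unfolded k_def[abs_def] N_eq]])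
  have "((\<lambda>x. gpsi1 p e x - ln x) \<longlongrightarrow> - 1 - 1 / a * I) at_top"
    unfolding psi1_eq I_def k_def N_eq
    using formal_mangoldt_nonneg[OF primes] psi_lim[unfolded psi_eq]
      csum_ln_eq_mangoldt_convolution[OF primes] E_lim[unfolded N_eq] N_lim[unfolded N_eq]
      int[unfolded k_def[abs_def] N_eq] a_pos
    by (rule csum_mangoldt_asymp)
  then have "((\<lambda>x. gpsi1 p e x - ln x - (- 1 - 1 / a * I)) \<longlongrightarrow> 0) at_top"
    by (rule LIM_zero)
  then have "(\<lambda>x. gpsi1 p e x - (ln x + (- 1 - 1 / a * I))) \<in> o[at_top](\<lambda>_. 1)"
    by (intro smalloI_tendsto) (simp_all add: algebra_simps)
  \<comment> \<open>The two formulas for \<open>c\<close> agree because the limit of the harmonic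
    sum is \<open>L = a + I\<close>.\<close>
  moreover have "- 1 - 1 / a * I = - (1 / a) * (a + I)" using a_pos by (simp add: field_simps)
  ultimately show ?thesis using L I_eq by blast
qed

end
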